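(* Let $G$ be an abelian group (written additively), let $\mathbf{a} = (a_1,\ldots,a_n)$ be a finite sequence of elements of $G$, and let $H = \mathrm{stab}(\Sigma(\mathbf{a}))$. Then $$|\Sigma(\mathbf{a})| \ge |H| + \tfrac{1}{64}|H| \cdot \sum_{j \in \mathbb{N}} \bigl(\rho^j_H(\mathbf{a})\bigr)^2.$$
   Context: $\Sigma(\mathbf{a})$ denotes the set of all sums of subsequences of $\mathbf{a}$, i.e. $\{\sum_{i\in I} a_i : I \subseteq \{1,\ldots,n\}\}$ (the empty sum being $0$). For $X \subseteq G$, $\mathrm{stab}(X) = \{g \in G : g + X = X\}$. For a subgroup $H \le G$, a nontrivial $H$-coset is an element of $G/H \setminus \{H\}$, and for each $j \in \mathbb{N}$, $\rho^j_H(\mathbf{a})$ is the number of nontrivial $H$-cosets of $G$ that contain at least $j$ terms of $\mathbf{a}$ (counted with multiplicity, i.e. cosets $Q$ with $|\{i : a_i \in Q\}| \ge j$). *)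

theory Defs
  imports "HOL-Algebra.Coset" "HOL-Algebra.FiniteProduct" "HOL-Analysis.Infinite_Sum"
begin

text \<open>
  An abelian group is a \<^locale>\<open>comm_group\<close>, so the group operation appears multiplicatively:
  sums of group elements are products \<^const>\<open>finprod\<close> and \<open>g + S\<close> is the translate
  \<open>g <#\<^bsub>G\<^esub> S\<close>.  A sequence \<open>(a\<^sub>1, \<dots>, a\<^sub>n)\<close> is a list, with indices running from \<open>0\<close>
  to \<open>n - 1\<close>.
\<close>

definition subseq_sums :: "('g, 'b) monoid_scheme \<Rightarrow> 'g list \<Rightarrow> 'g set" where
  "subseq_sums G a = {finprod G (\<lambda>i. a ! i) I |I. I \<subseteq> {..<length a}}"

definition stab :: "('g, 'b) monoid_scheme \<Rightarrow> 'g set \<Rightarrow> 'g set" where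
  "stab G S = {g \<in> carrier G. g <#\<^bsub>G\<^esub> S = S}"

text \<open>
  Only \<open>j \<ge> 1\<close> is meaningful: for \<open>j = 0\<close> all nontrivial cosets qualify, and there may be
  infinitely many of them.  For \<open>j \<ge> 1\<close> the set below is always finite (lemma
  \<open>finite_rich_cosets\<close>), so \<^const>\<open>card\<close> is its true cardinality.
\<close>

definition rich_cosets :: "('g, 'b) monoid_scheme \<Rightarrow> 'g set \<Rightarrow> 'g list \<Rightarrow> nat \<Rightarrow> 'g set set" where
  "rich_cosets G H a j =
     {Q \<in> carrier (G Mod H) - {H}. j \<le> card {i. i < length a \<and> a ! i \<in> Q}}"

definition rho :: "('g, 'b) monoid_scheme \<Rightarrow> 'g set \<Rightarrow> 'g list \<Rightarrow> nat \<Rightarrow> nat" where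
  "rho G H a j = card (rich_cosets G H a j)"

lemma finite_subseq_sums: "finite (subseq_sums G a)"
proof -
  have "subseq_sums G a = finprod G (\<lambda>i. a ! i) ` Pow {..<length a}"
    unfolding subseq_sums_def by auto
  then show ?thesis by simp
qed

lemma finite_stab_subseq_sums:
  assumes "comm_group G" and "set a \<subseteq> carrier G"
  shows "finite (stab G (subseq_sums G a))"
proof -
  interpret comm_group G by fact
  have one: "\<one>\<^bsub>G\<^esub> \<in> subseq_sums G a"
    unfolding subseq_sums_def using finprod_empty[of "\<lambda>i. a ! i"] by force
  have "g \<in> subseq_sums G a" if "g \<in> stab G (subseq_sums G a)" for g
  proof -
    from that have g: "g \<in> carrier G" "g <#\<^bsub>G\<^esub> subseq_sums G a = subseq_sums G a"
      by (auto simp: stab_def)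
    have "g \<otimes>\<^bsub>G\<^esub> \<one>\<^bsub>G\<^esub> \<in> g <#\<^bsub>G\<^esub> subseq_sums G a"
      using one unfolding l_coset_def by blast
    then show ?thesis using g by simp
  qed
  then show ?thesis by (intro finite_subset[OF subsetI finite_subseq_sums])
qed

lemma finite_rich_cosets:
  assumes "comm_group G" and "subgroup H G" and "j \<ge> 1"
  shows "finite (rich_cosets G H a j)"
proof -
  interpret comm_group G by fact
  have "rich_cosets G H a j \<subseteq> (\<lambda>x. H #>\<^bsub>G\<^esub> x) ` set a"
  proof
    fix Q assume "Q \<in> rich_cosets G H a j"
    then have Q: "Q \<in> rcosets\<^bsub>G\<^esub> H" and c: "1 \<le> card {i. i < length a \<and> a ! i \<in> Q}"
      using assms(3) by (auto simp: rich_cosets_def FactGroup_def)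
    from c have "{i. i < length a \<and> a ! i \<in> Q} \<noteq> {}" by force
    then obtain i where i: "i < length a" "a ! i \<in> Q" by blast
    obtain x where x: "x \<in> carrier G" "Q = H #>\<^bsub>G\<^esub> x" using Q by (auto simp: RCOSETS_def)
    then have "Q = H #>\<^bsub>G\<^esub> (a ! i)" using repr_independence[OF _ x(1) assms(2)] i by simp
    then show "Q \<in> (\<lambda>x. H #>\<^bsub>G\<^esub> x) ` set a" using i by simp
  qed
  then show ?thesis by (rule finite_subset) simp
qed

lemma rho_eq_0: "rho G H a j = 0" if "j > length a"
proof -
  have "card {i. i < length a \<and> a ! i \<in> Q} \<le> length a" for Q
    using card_mono[of "{..<length a}" "{i. i < length a \<and> a ! i \<in> Q}"] by auto
  then have "\<not> j \<le> card {i. i < length a \<and> a ! i \<in> Q}" for Q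
    using that by (meson le_trans not_le)
  then have "rich_cosets G H a j = {}"
    unfolding rich_cosets_def by blast
  then show ?thesis by (simp add: rho_def)
qed

lemma infsum_rho:
  "(\<Sum>\<^sub>\<infinity>j\<in>{1..}. (real (rho G H a j))\<^sup>2) = (\<Sum>j=1..length a. (real (rho G H a j))\<^sup>2)"
proof -
  have "(\<Sum>\<^sub>\<infinity>j\<in>{1..}. (real (rho G H a j))\<^sup>2) = (\<Sum>\<^sub>\<infinity>j\<in>{1..length a}. (real (rho G H a j))\<^sup>2)"
    by (rule infsum_cong_neutral) (auto simp: rho_eq_0)
  then show ?thesis by simp
qed

end

theory Submission
  imports Defs "HOL-Algebra.Generated_Groups"
begin

text \<open>
  Factoring out \<open>H\<close>, one may assume that the stabiliser is trivial; the sum over \<open>j\<close> is then the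
  ``energy'' \<open>F(a)\<close>, the sum of the squares of the numbers of nontrivial elements of multiplicity at
  least \<open>j\<close>.  The proof is by induction on the length of \<open>a\<close>.

  Split \<open>a\<close> into a chosen part \<open>C\<close> and a remainder \<open>R\<close>, initially \<open>R = a\<close>, and move terms from \<open>R\<close> to
  \<open>C\<close> greedily, as long as \<open>R\<close> generates the same subgroup \<open>K\<close> as \<open>a\<close>.  By an argument in the style
  of Erdos--Heilbronn and Olson, some term of \<open>R\<close> either enlarges \<open>|\<Sigma>(C)| + 1\<close> by a factor \<open>3/2\<close>, or
  increases \<open>|\<Sigma>(C)|\<close> by at least a twelfth of the number of distinct nontrivial terms of \<open>R\<close>; the only
  obstruction, that \<open>\<Sigma>(C)\<close> nearly fills \<open>K\<close>, would force \<open>\<Sigma>(a) = K\<close>, which is periodic.  When \<open>R\<close>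
  finally generates a proper subgroup of \<open>K\<close>, the set \<open>\<Sigma>(a)\<close> meets at least two cosets of it, so that
  \<open>|\<Sigma>(a)| \<ge> 2 |\<Sigma>(R)|\<close>.  If \<open>F(R)\<close> is at least about half of \<open>F(a)\<close>, the induction hypothesis for \<open>R\<close>
  suffices; otherwise enough energy was lost on the way for \<open>|\<Sigma>(a)| \<ge> |\<Sigma>(C)|\<close> to suffice.
\<close>

section \<open>Subsequence sums\<close>

lemma l_coset_eq_image: "x <#\<^bsub>G\<^esub> B = (\<lambda>b. x \<otimes>\<^bsub>G\<^esub> b) ` B"
  by (auto simp: l_coset_def)

context comm_group
begin

lemma inj_on_l_mult: "x \<in> carrier G \<Longrightarrow> inj_on (\<lambda>b. x \<otimes> b) (carrier G)"
  by (intro inj_onI) (simp add: Units_eq)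

lemma card_l_coset:
  assumes "x \<in> carrier G" "B \<subseteq> carrier G"
  shows "card (x <# B) = card B"
  using inj_on_subset[OF inj_on_l_mult[OF assms(1)] assms(2)]
  by (simp add: l_coset_eq_image card_image)

lemma subseq_sums_Nil: "subseq_sums G [] = {\<one>}"
  by (auto simp: subseq_sums_def)

text \<open>Index sets are split by whether they contain 0, and the rest is shifted by one. Later
  arguments work with this recursion instead of index sets.\<close>

lemma subseq_sums_Cons:
  assumes "x \<in> carrier G" "set xs \<subseteq> carrier G"
  shows "subseq_sums G (x # xs) = subseq_sums G xs \<union> (x <# subseq_sums G xs)"
proof -
  let ?f = "\<lambda>i. (x # xs) ! i"
  have nth: "xs ! i \<in> carrier G" if "i < length xs" for i
    using that assms(2) nth_mem by blast
  have shift: "finprod G ?f (Suc ` I) = finprod G (\<lambda>i. xs ! i) I" if "I \<subseteq> {..<length xs}" for I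
    using that nth by (subst finprod_reindex) auto
  have split: "finprod G ?f (insert 0 (Suc ` I)) = x \<otimes> finprod G (\<lambda>i. xs ! i) I"
    if "I \<subseteq> {..<length xs}" for I
  proof -
    have "finprod G ?f (insert 0 (Suc ` I)) = ?f 0 \<otimes> finprod G ?f (Suc ` I)"
      by (rule finprod_insert) (use that nth assms(1) finite_subset[OF that] in auto)
    then show ?thesis using shift[OF that] by simp
  qed
  have "\<exists>J\<subseteq>{..<length xs}. I = Suc ` J \<or> I = insert 0 (Suc ` J)" if "I \<subseteq> {..<Suc (length xs)}" for I
  proof (intro exI[of _ "{j. Suc j \<in> I}"] conjI)
    show "{j. Suc j \<in> I} \<subseteq> {..<length xs}" using that by auto
    have "i \<in> Suc ` {j. Suc j \<in> I}" if "i \<in> I" "i \<noteq> 0" for i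
      using that by (cases i) auto
    then show "I = Suc ` {j. Suc j \<in> I} \<or> I = insert 0 (Suc ` {j. Suc j \<in> I})"
      by (cases "0 \<in> I") (blast, auto)
  qed
  then have "subseq_sums G (x # xs) \<subseteq> subseq_sums G xs \<union> (x <# subseq_sums G xs)"
    unfolding subseq_sums_def l_coset_eq_image
    using shift split by (simp add: subset_iff) (smt (verit) imageI mem_Collect_eq)
  moreover have "subseq_sums G xs \<union> (x <# subseq_sums G xs) \<subseteq> subseq_sums G (x # xs)"
  proof
    fix y assume "y \<in> subseq_sums G xs \<union> (x <# subseq_sums G xs)"
    then obtain I where I: "I \<subseteq> {..<length xs}"
      and y: "y = finprod G (\<lambda>i. xs ! i) I \<or> y = x \<otimes> finprod G (\<lambda>i. xs ! i) I"
      by (auto simp: subseq_sums_def l_coset_eq_image)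
    then have "y = finprod G ?f (Suc ` I) \<or> y = finprod G ?f (insert 0 (Suc ` I))"
      using shift split by auto
    moreover have "Suc ` I \<subseteq> {..<length (x # xs)}" "insert 0 (Suc ` I) \<subseteq> {..<length (x # xs)}"
      using I by auto
    ultimately show "y \<in> subseq_sums G (x # xs)"
      unfolding subseq_sums_def by blast
  qed
  ultimately show ?thesis by blast
qed

lemma subseq_sums_closed: "set xs \<subseteq> carrier G \<Longrightarrow> subseq_sums G xs \<subseteq> carrier G"
  by (induction xs) (auto simp: subseq_sums_Nil subseq_sums_Cons l_coset_eq_image)

lemma one_in_subseq_sums: "set xs \<subseteq> carrier G \<Longrightarrow> \<one> \<in> subseq_sums G xs"
  by (induction xs) (auto simp: subseq_sums_Nil subseq_sums_Cons)

lemma set_subset_subseq_sums: "set xs \<subseteq> carrier G \<Longrightarrow> set xs \<subseteq> subseq_sums G xs"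
proof (induction xs)
  case (Cons x xs)
  then have "x \<otimes> \<one> \<in> x <# subseq_sums G xs"
    using one_in_subseq_sums[of xs] unfolding l_coset_eq_image by (intro imageI) auto
  with Cons show ?case by (auto simp: subseq_sums_Cons)
qed simp

lemma subseq_sums_append:
  assumes "set xs \<subseteq> carrier G" "set ys \<subseteq> carrier G"
  shows "subseq_sums G (xs @ ys) = subseq_sums G xs <#> subseq_sums G ys"
  using assms(1)
proof (induction xs)
  case Nil
  then show ?case
    using subseq_sums_closed[OF assms(2)]
    by (force simp: subseq_sums_Nil set_mult_def)
next
  case (Cons x xs)
  have "subseq_sums G xs \<subseteq> carrier G" "subseq_sums G ys \<subseteq> carrier G"
    using Cons.prems assms(2) subseq_sums_closed by auto
  then have "x <# (subseq_sums G xs <#> subseq_sums G ys)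
      = (x <# subseq_sums G xs) <#> subseq_sums G ys"
    using Cons.prems setmult_lcos_assoc by simp
  then show ?case
    using Cons assms(2) by (simp add: subseq_sums_Cons) (auto simp: set_mult_def)
qed

text \<open>Translations commute, so \<open>x\<close> can be pulled past every earlier term. This
  keeps \<Sigma>(C @ R) fixed when a term moves from \<open>R\<close> to \<open>C\<close>.\<close>

lemma subseq_sums_remove1:
  assumes "set xs \<subseteq> carrier G" "x \<in> set xs"
  shows "subseq_sums G xs = subseq_sums G (x # remove1 x xs)"
  using assms
proof (induction xs)
  case (Cons y xs)
  show ?case
  proof (cases "x = y")
    case False
    then have x: "x \<in> set xs" "x \<in> carrier G" "y \<in> carrier G" "set xs \<subseteq> carrier G"
      using Cons.prems by auto
    have r: "set (remove1 x xs) \<subseteq> carrier G"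
      using x(4) set_remove1_subset by fast
    let ?S = "subseq_sums G (remove1 x xs)"
    have "y <# (x <# ?S) = x <# (y <# ?S)"
      using x subseq_sums_closed[OF r] by (simp add: lcos_m_assoc m_comm)
    moreover have "subseq_sums G xs = ?S \<union> (x <# ?S)"
      using Cons.IH x r by (simp add: subseq_sums_Cons)
    ultimately show ?thesis
      using False x r by (simp add: subseq_sums_Cons l_coset_eq_image image_Un Un_ac)
  qed simp
qed simp

lemma subseq_sums_subset_generate:
  assumes "set xs \<subseteq> K" "subgroup K G"
  shows "subseq_sums G xs \<subseteq> K"
  using assms(1)
proof (induction xs)
  case Nil
  then show ?case using assms(2) by (simp add: subseq_sums_Nil subgroup.one_closed)
next
  case (Cons x xs)
  have "K \<subseteq> carrier G" using assms(2) by (rule subgroup.subset)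
  with Cons show ?case
    using subgroup.m_closed[OF assms(2)]
    by (subst subseq_sums_Cons) (auto simp: l_coset_eq_image)
qed

text \<open>A translation of the product set can be moved onto the factor \<open>Y\<close>. Hence a
  period of \<Sigma>(R) is a period of \<Sigma>(a), and the remainder \<open>R\<close> inherits
  aperiodicity in the induction.\<close>

lemma stab_set_mult:
  assumes "X \<subseteq> carrier G" "Y \<subseteq> carrier G"
  shows "stab G Y \<subseteq> stab G (X <#> Y)"
proof
  fix g assume g: "g \<in> stab G Y"
  have "g <# (X <#> Y) = X <#> (g <# Y)"
  proof -
    have "g \<otimes> (u \<otimes> v) = u \<otimes> (g \<otimes> v)" if "u \<in> X" "v \<in> Y" for u v
      using that assms g m_lcomm by (auto simp: stab_def subset_iff)
    moreover have "g <# (X <#> Y) = (\<Union>u\<in>X. \<Union>v\<in>Y. {g \<otimes> (u \<otimes> v)})"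
      by (auto simp: l_coset_eq_image set_mult_def)
    moreover have "X <#> (g <# Y) = (\<Union>u\<in>X. \<Union>v\<in>Y. {u \<otimes> (g \<otimes> v)})"
      by (auto simp: l_coset_eq_image set_mult_def)
    ultimately show ?thesis by simp
  qed
  with g show "g \<in> stab G (X <#> Y)" by (simp add: stab_def)
qed

section \<open>Expansion of a finite set under a translation\<close>

text \<open>Olson's function, usually written \<lambda>_B(x). For B = \<Sigma>(C) it is the gain in
  |\<Sigma>(C)| when \<open>x\<close> is appended to \<open>C\<close>.\<close>

definition expansion :: "'a set \<Rightarrow> 'a \<Rightarrow> nat" where
  "expansion B x = card ((x <# B) - B)"

lemma expansion_one: "B \<subseteq> carrier G \<Longrightarrow> expansion B \<one> = 0"
  by (simp add: expansion_def lcos_mult_one)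

lemma card_Un_l_coset:
  assumes "finite B"
  shows "card (B \<union> (x <# B)) = card B + expansion B x"
proof -
  have "card (B \<union> ((x <# B) - B)) = card B + card ((x <# B) - B)"
    using assms by (intro card_Un_disjoint) (auto simp: l_coset_eq_image)
  then show ?thesis by (simp add: expansion_def)
qed

text \<open>If x y b lies outside \<open>B\<close>, then either y b already does, or y b is in
  \<open>B\<close> and \<open>x\<close> carries it out.\<close>

lemma expansion_mult:
  assumes "finite B" "B \<subseteq> carrier G" "x \<in> carrier G" "y \<in> carrier G"
  shows "expansion B (x \<otimes> y) \<le> expansion B x + expansion B y"
proof -
  have "((x \<otimes> y) <# B) - B \<subseteq> (x <# ((y <# B) - B)) \<union> ((x <# B) - B)"
  proof
    fix z assume "z \<in> ((x \<otimes> y) <# B) - B"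
    then obtain b where b: "b \<in> B" "z = x \<otimes> (y \<otimes> b)" "z \<notin> B"
      using assms by (auto simp: l_coset_eq_image m_assoc)
    then show "z \<in> (x <# ((y <# B) - B)) \<union> ((x <# B) - B)"
      by (cases "y \<otimes> b \<in> B") (auto simp: l_coset_eq_image)
  qed
  then have "expansion B (x \<otimes> y) \<le> card ((x <# ((y <# B) - B)) \<union> ((x <# B) - B))"
    unfolding expansion_def using assms(1) by (intro card_mono) (auto simp: l_coset_eq_image)
  also have "\<dots> \<le> card (x <# ((y <# B) - B)) + expansion B x"
    unfolding expansion_def by (rule card_Un_le)
  also have "card (x <# ((y <# B) - B)) = expansion B y"
    unfolding expansion_def using assms l_coset_subset_G[OF assms(2,4)] by (intro card_l_coset) auto
  finally show ?thesis by simp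
qed

lemma card_Diff_l_coset:
  assumes "finite B" "B \<subseteq> carrier G" "x \<in> carrier G"
  shows "card (B - (x <# B)) = expansion B x"
proof -
  have "finite (x <# B)" using assms(1) by (simp add: l_coset_eq_image)
  then show ?thesis
    using assms card_l_coset[OF assms(3,2)]
    by (simp add: expansion_def card_Diff_subset_Int Int_commute)
qed

text \<open>Multiplication by \<open>inv x\<close> maps B - xB onto (inv x)B - B, and B - xB is as
  large as xB - B because |xB| = |B|.\<close>

lemma expansion_inv:
  assumes "finite B" "B \<subseteq> carrier G" "x \<in> carrier G"
  shows "expansion B (inv x) = expansion B x"
proof -
  have inj: "inj_on (\<lambda>b. inv x \<otimes> b) (carrier G)"
    using assms(3) by (intro inj_on_l_mult) simp
  have "inv x <# (x <# B) = B"
    using assms by (simp add: lcos_m_assoc lcos_mult_one)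
  moreover have "inv x <# (B - (x <# B)) = (inv x <# B) - (inv x <# (x <# B))"
    unfolding l_coset_eq_image[of G "inv x"]
    using assms l_coset_subset_G[OF assms(2,3)] by (intro inj_on_image_set_diff[OF inj]) auto
  ultimately have "(inv x <# B) - B = inv x <# (B - (x <# B))" by simp
  then have "expansion B (inv x) = card (B - (x <# B))"
    unfolding expansion_def using assms by (simp add: card_l_coset subset_iff)
  then show ?thesis using card_Diff_l_coset[OF assms] by simp
qed

text \<open>Since xK = K, the part of x(K - B) outside K - B is B - xB. This allows a set filling
  more than half of \<open>K\<close> to be replaced by its complement.\<close>

lemma expansion_compl:
  assumes K: "subgroup K G" "finite K" and B: "B \<subseteq> K" and x: "x \<in> K"
  shows "expansion (K - B) x = expansion B x"
proof -
  have KG: "K \<subseteq> carrier G" using K(1) by (rule subgroup.subset)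
  have inj: "inj_on (\<lambda>b. x \<otimes> b) (carrier G)"
    using KG x by (intro inj_on_l_mult) auto
  have "x <# (K - B) = (x <# K) - (x <# B)"
    unfolding l_coset_eq_image using KG B by (intro inj_on_image_set_diff[OF inj]) auto
  also have "x <# K = K" using K(1) x KG by (intro coset_join3) auto
  finally have "(x <# (K - B)) - (K - B) = B - (x <# B)" using B by blast
  moreover have "card (B - (x <# B)) = expansion B x"
    using assms KG finite_subset[OF B] by (intro card_Diff_l_coset) auto
  ultimately show ?thesis by (simp add: expansion_def)
qed

text \<open>Double counting: |B| minus the expansion at \<open>x\<close> is |xB \<inter> B|, and the
  pairs (x, c) with c in xB \<inter> B embed into B \<times> B through (inv x c, c).\<close>

lemma sum_expansion_ge:
  assumes "finite B" "B \<subseteq> carrier G" "finite E" "E \<subseteq> carrier G"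
  shows "card B * card E \<le> (\<Sum>x\<in>E. expansion B x) + (card B)\<^sup>2"
proof -
  let ?P = "SIGMA x:E. (x <# B) \<inter> B"
  have fin: "finite ((x <# B) \<inter> B)" for x using assms(1) by simp
  have "card B = expansion B x + card ((x <# B) \<inter> B)" if "x \<in> E" for x
  proof -
    have "card ((x <# B) \<inter> B) + expansion B x = card (x <# B)"
      unfolding expansion_def using assms(1) by (metis Int_Diff_Un Int_Diff_disjoint card_Un_disjoint
          finite_Diff finite_Int finite_imageI l_coset_eq_image)
    then show ?thesis using that assms card_l_coset by (metis add.commute subsetD)
  qed
  then have "(\<Sum>x\<in>E. card B) = (\<Sum>x\<in>E. expansion B x + card ((x <# B) \<inter> B))"
    by (intro sum.cong) auto
  then have eq: "card B * card E = (\<Sum>x\<in>E. expansion B x) + card ?P"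
    using assms(3) fin by (simp add: sum.distrib mult.commute)
  have "inj_on (\<lambda>(x, c). (inv x \<otimes> c, c)) ?P"
  proof (rule inj_onI, clarsimp)
    fix x y c assume "x \<in> E" "y \<in> E" "c \<in> B" "inv x \<otimes> c = inv y \<otimes> c"
    moreover from this have "x \<in> carrier G" "y \<in> carrier G" "c \<in> carrier G" using assms by auto
    ultimately show "x = y" by (metis inv_closed inv_inv right_cancel)
  qed
  moreover have "(\<lambda>(x, c). (inv x \<otimes> c, c)) ` ?P \<subseteq> B \<times> B"
  proof clarsimp
    fix x c assume "x \<in> E" "c \<in> B" "c \<in> x <# B"
    then show "inv x \<otimes> c \<in> B"
      using assms by (auto simp: l_coset_eq_image subset_iff m_assoc[symmetric])
  qed
  ultimately have "card ?P \<le> card (B \<times> B)"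
    using assms(1) by (intro card_inj_on_le[of _ ?P]) auto
  then show ?thesis using eq by (simp add: card_cartesian_product power2_eq_square)
qed

section \<open>Existence of an expanding element\<close>

text \<open>
  Let \<open>\<mu>\<close> be the maximal expansion over \<open>D\<close> and \<open>S = D \<union> D\<inverse> \<union> {1}\<close>.  By subadditivity the level sets
  \<open>N k = {x. expansion B x \<le> k \<mu>}\<close> satisfy \<open>N j S \<subseteq> N (j + 1)\<close>.  If \<open>y\<close> lies in \<open>N (k + 2)\<close> but not in
  \<open>N (k + 1)\<close>, then \<open>y S\<close> is disjoint from \<open>N k\<close>, so the level sets gain \<open>card S\<close> elements every three
  steps; on the other hand the expansion is on average at least \<open>card B / 2\<close> over any set of size
  at least \<open>2 card B\<close>, so the level sets cannot grow beyond that size too quickly.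
\<close>

lemma exists_expanding:
  assumes D: "finite D" "D \<subseteq> carrier G"
    and B: "finite B" "B \<subseteq> generate G D" "B \<noteq> {}"
    and big: "\<exists>E\<subseteq>generate G D. finite E \<and> 2 * card B \<le> card E"
  shows "\<exists>x\<in>D. card B + 1 \<le> 2 * expansion B x \<or> card (D - {\<one>}) + 1 \<le> 12 * expansion B x"
proof (rule ccontr)
  assume neg: "\<not> ?thesis"
  define K where "K = generate G D"
  define S where "S = insert \<one> (D \<union> m_inv G ` D)"
  define u where "u = card S"
  define b where "b = card B"
  \<comment> \<open>The inserted 0 is the default for empty \<open>D\<close>.\<close>
  define \<mu> where "\<mu> = Max (insert 0 (expansion B ` D))"
  define N where "N k = {x \<in> K. expansion B x \<le> k * \<mu>}" for k
  have K: "subgroup K G" unfolding K_def using D(2) by (rule generate_is_subgroup)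
  have KG: "K \<subseteq> carrier G" using K by (rule subgroup.subset)
  have BG: "B \<subseteq> carrier G" using B(2) KG K_def by blast
  have finS: "finite S" using D(1) by (simp add: S_def)
  have SK: "S \<subseteq> K"
    unfolding S_def K_def by (auto intro: generate.intros)
  have one_S: "\<one> \<in> S" by (simp add: S_def)
  have S_inv: "inv s \<in> S" if "s \<in> S" for s
    using that D(2) by (auto simp: S_def)
  have b: "b > 0" using B by (simp add: b_def card_gt_0_iff)
  have exp_le: "expansion B d \<le> \<mu>" if "d \<in> D" for d
    unfolding \<mu>_def using D(1) that by (intro Max_ge) auto
  have exp_S: "expansion B s \<le> \<mu>" if "s \<in> S" for s
    using that exp_le expansion_inv[OF B(1) BG] expansion_one[OF BG] D(2) by (auto simp: S_def)
  have "card (D - {\<one>}) + 1 = card (insert \<one> (D - {\<one>}))"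
    using D(1) by (subst card_insert_disjoint) auto
  also have "\<dots> \<le> u" unfolding u_def using finS by (intro card_mono) (auto simp: S_def)
  finally have u: "card (D - {\<one>}) < u" by simp
  have "\<mu> \<in> insert 0 (expansion B ` D)"
    unfolding \<mu>_def using D(1) by (intro Max_in) auto
  \<comment> \<open>Both alternatives of the claim fail for every element of \<open>D\<close>, hence
    for the maximum.\<close>
  then have \<mu>: "12 * \<mu> < u" "2 * \<mu> \<le> b"
    using neg u by (auto simp: b_def not_le)
  have N_mult: "x \<otimes> s \<in> N (Suc k)" if "x \<in> N k" "s \<in> S" for x s k
  proof -
    have "expansion B (x \<otimes> s) \<le> expansion B x + expansion B s"
      using that SK KG by (intro expansion_mult[OF B(1) BG]) (auto simp: N_def)
    then show ?thesis
      using that exp_S[of s] SK subgroup.m_closed[OF K] by (auto simp: N_def)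
  qed
  have N_mono: "N j \<subseteq> N k" if "j \<le> k" for j k
    using mult_right_mono[OF that, of \<mu>] by (auto simp: N_def intro: order_trans)
  have N_subset: "N k \<subseteq> K" for k by (auto simp: N_def)
  have one_N: "\<one> \<in> N k" for k
    using expansion_one[OF BG] subgroup.one_closed[OF K] by (simp add: N_def)
  \<comment> \<open>Otherwise \<open>N k\<close>, which contains the identity, would be closed under
    multiplication by \<open>D\<close> and its inverses, hence equal to \<open>K\<close>.\<close>
  have exit: "\<exists>z\<in>N k. \<exists>s\<in>S. z \<otimes> s \<notin> N k" if "N k \<noteq> K" for k
  proof (rule ccontr)
    assume "\<not> ?thesis"
    then have closed: "z \<otimes> s \<in> N k" if "z \<in> N k" "s \<in> S" for z s using that by blast
    have N_G: "N k \<subseteq> carrier G" using KG by (auto simp: N_def)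
    have "\<forall>z\<in>N k. z \<otimes> x \<in> N k" if "x \<in> generate G D" for x
      using that
    proof induction
      case one then show ?case using N_G by auto
    next
      case (incl h) then show ?case using closed by (auto simp: S_def)
    next
      case (inv h) then show ?case using closed by (auto simp: S_def)
    next
      case (eng x y)
      then have "x \<in> carrier G" "y \<in> carrier G" using KG K_def by auto
      then have "z \<otimes> (x \<otimes> y) = (z \<otimes> x) \<otimes> y" if "z \<in> N k" for z
        using that N_G by (simp add: m_assoc subset_iff)
      with eng.IH show ?case by simp
    qed
    then have "\<one> \<otimes> x \<in> N k" if "x \<in> K" for x using that one_N K_def by blast
    then have "K \<subseteq> N k" using KG by (auto simp: subset_iff)
    with \<open>N k \<noteq> K\<close> show False by (auto simp: N_def)
  qed
  \<comment> \<open>The second alternative records that the level sets have exhausted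
    \<open>K\<close>: for i = i' + 1 the index 3i - 1 is 3i' + 2, the level that the inductive step
    has to leave.\<close>
  have growth: "(\<exists>E\<subseteq>N (3 * i + 1). finite E \<and> card E = (i + 1) * u) \<or> (i \<ge> 1 \<and> N (3 * i - 1) = K)" for i
  proof (induction i)
    case 0
    have "S \<subseteq> N (3 * 0 + 1)" using SK exp_S by (auto simp: N_def)
    then show ?case using finS u_def by auto
  next
    case (Suc i)
    show ?case
    proof (cases "N (3 * i + 2) = K")
      case False
      have "N (3 * i - 1) \<noteq> K"
        using False N_mono[of "3 * i - 1" "3 * i + 2"] N_subset[of "3 * i + 2"] by auto
      then obtain E where E: "E \<subseteq> N (3 * i + 1)" "finite E" "card E = (i + 1) * u"
        using Suc.IH by blast
      obtain z s where z: "z \<in> N (3 * i + 2)" "s \<in> S" "z \<otimes> s \<notin> N (3 * i + 2)"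
        using exit[OF False] by blast
      define y where "y = z \<otimes> s"
      have y: "y \<in> N (3 * i + 3)" "y \<in> carrier G" "y \<notin> N (3 * i + 2)"
        using N_mult[OF z(1,2)] z KG by (auto simp: y_def N_def numeral_3_eq_3)
      have yS: "y <# S \<subseteq> N (3 * i + 4)"
      proof -
        have "y \<otimes> t \<in> N (3 * i + 4)" if "t \<in> S" for t
          using N_mult[OF y(1) that] by (simp add: add.commute)
        then show ?thesis by (auto simp: l_coset_eq_image)
      qed
      have "y \<otimes> t \<notin> N (3 * i + 1)" if "t \<in> S" for t
      proof
        assume "y \<otimes> t \<in> N (3 * i + 1)"
        from N_mult[OF this S_inv[OF that]] have "y \<otimes> t \<otimes> inv t \<in> N (3 * i + 2)" by simp
        moreover have "t \<in> carrier G" using that SK KG by blast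
        ultimately show False using y by (simp add: m_assoc)
      qed
      then have "E \<inter> (y <# S) = {}" using E(1) by (auto simp: l_coset_eq_image)
      then have "card (E \<union> (y <# S)) = (Suc i + 1) * u"
        using E finS card_l_coset[of y S] y(2) SK KG
        by (subst card_Un_disjoint) (auto simp: l_coset_eq_image u_def)
      moreover have "E \<union> (y <# S) \<subseteq> N (3 * Suc i + 1)"
      proof -
        have "3 * Suc i + 1 = 3 * i + 4" by simp
        then show ?thesis using E(1) yS N_mono[of "3 * i + 1" "3 * i + 4"] by (metis (no_types, lifting) Un_least le_add1 order_trans add_le_cancel_left one_le_numeral)
      qed
      moreover have "finite (E \<union> (y <# S))" using E finS by (simp add: l_coset_eq_image)
      ultimately show ?thesis by blast
    qed simp
  qed
  have average: "b * card E \<le> card E * (k * \<mu>) + b\<^sup>2" if "finite E" "E \<subseteq> N k" for E k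
  proof -
    have "b * card E \<le> (\<Sum>x\<in>E. expansion B x) + b\<^sup>2"
      unfolding b_def using that KG by (intro sum_expansion_ge[OF B(1) BG]) (auto simp: N_def)
    also have "(\<Sum>x\<in>E. expansion B x) \<le> card E * (k * \<mu>)"
      using that sum_bounded_above[of E "expansion B" "k * \<mu>"] by (auto simp: N_def)
    finally show ?thesis by simp
  qed
  have "2 * b \<le> (2 * b + 1) * u" using u by (cases u) auto
  then have ex: "\<exists>i. 2 * b \<le> (i + 1) * u" by blast
  \<comment> \<open>By minimality, e = (i + 1)u satisfies 2b \<le> e < 2b + u as soon as i >
    0.\<close>
  define i where "i = (LEAST i. 2 * b \<le> (i + 1) * u)"
  have i: "2 * b \<le> (i + 1) * u" unfolding i_def using ex by (rule LeastI_ex)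
  show False
  proof (cases i)
    case 0
    \<comment> \<open>Here u \<ge> 2b. The identity has expansion 0, so only u - 1 terms count; with
      \<open>u\<close> terms the case u = 2b would give no contradiction.\<close>
    have "b * u \<le> (\<Sum>x\<in>S. expansion B x) + b\<^sup>2"
      unfolding b_def u_def using finS SK KG by (intro sum_expansion_ge[OF B(1) BG]) auto
    also have "(\<Sum>x\<in>S. expansion B x) = (\<Sum>x\<in>S - {\<one>}. expansion B x)"
      using finS expansion_one[OF BG] by (intro sum.mono_neutral_right) auto
    also have "\<dots> \<le> (u - 1) * \<mu>"
      using sum_bounded_above[of "S - {\<one>}" "expansion B" \<mu>] exp_S
        card_Diff_singleton[OF one_S]
      by (simp add: u_def)
    finally have "2 * (b * u) \<le> (u - 1) * (2 * \<mu>) + 2 * b\<^sup>2" by simp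
    also have "\<dots> \<le> (u - 1) * b + 2 * b\<^sup>2" using \<mu>(2) by simp
    finally have "b * (2 * u) \<le> b * (u - 1 + 2 * b)" by (simp add: algebra_simps power2_eq_square)
    then show False using b i 0 u by simp
  next
    case (Suc i')
    have "\<not> 2 * b \<le> (i' + 1) * u"
      using not_less_Least[of i' "\<lambda>i. 2 * b \<le> (i + 1) * u"] Suc by (simp add: i_def)
    then have iu: "i * u < 2 * b" using Suc by simp
    from growth[of i] show False
    proof
      assume "\<exists>E\<subseteq>N (3 * i + 1). finite E \<and> card E = (i + 1) * u"
      then obtain E where E: "E \<subseteq> N (3 * i + 1)" "finite E" "card E = (i + 1) * u" by blast
      have "b * ((i + 1) * u) \<le> (i + 1) * u * ((3 * i + 1) * \<mu>) + b\<^sup>2"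
        using average[OF E(2,1)] unfolding E(3) .
      then have "int (b * ((i + 1) * u)) \<le> int ((i + 1) * u * ((3 * i + 1) * \<mu>) + b\<^sup>2)"
        by (simp only: of_nat_le_iff)
      \<comment> \<open>Multiplying the averaged bound by 12, with 12\<mu> < u and (3i + 1)u = 3(i +
        1)u - 2u, gives 2ue \<le> 3(e - 2b)^2. The right side is at most 3u^2 by the choice of
        \<open>i\<close>, while i \<ge> 1 makes the left side at least 4u^2.\<close>
      define e where "e = (int i + 1) * int u"
      have h: "int b * e \<le> e * ((3 * int i + 1) * int \<mu>) + (int b)\<^sup>2"
        using \<open>int (b * ((i + 1) * u)) \<le> _\<close> by (simp add: e_def algebra_simps)
      have "int (2 * b) \<le> int ((i + 1) * u)" "int (i * u) < int (2 * b)"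
        using i iu by (simp_all only: of_nat_le_iff of_nat_less_iff)
      then have e: "e - 2 * int b \<ge> 0" "e - 2 * int b < int u"
        by (simp_all add: e_def algebra_simps)
      have "(e - 2 * int b)\<^sup>2 \<le> (int u)\<^sup>2" using e by (intro power_mono) auto
      moreover have "12 * (int b * e) \<le> (e * (3 * int i + 1)) * (12 * int \<mu>) + 12 * (int b)\<^sup>2"
        using h by (simp add: algebra_simps)
      moreover have "(e * (3 * int i + 1)) * (12 * int \<mu>) \<le> (e * (3 * int i + 1)) * int u"
        using \<mu>(1) by (intro mult_left_mono) (auto simp: e_def)
      moreover have "(e * (3 * int i + 1)) * int u = 3 * e\<^sup>2 - 2 * (int u * e)"
        by (simp add: e_def algebra_simps power2_eq_square)
      moreover have "int u * e \<ge> 2 * (int u)\<^sup>2"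
      proof -
        have "int u * (2 * int u) \<le> int u * e" unfolding e_def using Suc
          by (intro mult_left_mono mult_right_mono) auto
        then show ?thesis by (simp add: power2_eq_square)
      qed
      moreover have "(int u)\<^sup>2 > 0" using u by simp
      moreover have "(e - 2 * int b)\<^sup>2 = e\<^sup>2 - 4 * (int b * e) + 4 * (int b)\<^sup>2"
        by (simp add: power2_eq_square algebra_simps)
      ultimately show False by linarith
    next
      assume K_eq: "1 \<le> i \<and> N (3 * i - 1) = K"
      \<comment> \<open>All of \<open>K\<close> lies in one level set, so averaging over any
        \<open>E\<close> with at least 2b elements gives b \<le> 2(3i - 1)\<mu>. With 12\<mu> < u
        this contradicts iu < 2b.\<close>
      obtain E where E: "E \<subseteq> K" "finite E" "2 * b \<le> card E"
        using big by (auto simp: K_def b_def)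
      have "b * card E \<le> card E * ((3 * i - 1) * \<mu>) + b\<^sup>2"
        using E K_eq by (intro average) auto
      then have "card E * (2 * b) \<le> card E * (2 * ((3 * i - 1) * \<mu>)) + b * (2 * b)"
        by (simp add: algebra_simps power2_eq_square)
      also have "b * (2 * b) \<le> card E * b" using E(3) by simp
      finally have "card E * (2 * b) \<le> card E * (2 * ((3 * i - 1) * \<mu>) + b)"
        by (simp add: algebra_simps)
      then have "b \<le> 2 * ((3 * i - 1) * \<mu>)" using E(3) b by simp
      then have "6 * b \<le> (3 * i - 1) * (12 * \<mu>)" by (simp add: ac_simps)
      also have "\<dots> \<le> (3 * i - 1) * u" using \<mu>(1) by (intro mult_left_mono) auto
      also have "\<dots> \<le> 3 * (i * u)" by (simp add: algebra_simps)
      finally show False using iu by simp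
    qed
  qed
qed

text \<open>If \<open>B\<close> fills more than half of a finite subgroup, the complement is used
  instead; it has the same expansions. The first alternative for the complement implies the second
  one for \<open>B\<close>, because the complement has more than |D - {1}| elements.\<close>

lemma exists_expanding_if_large_compl:
  assumes D: "finite D" "D \<subseteq> carrier G"
    and B: "finite B" "B \<subseteq> generate G D" "B \<noteq> {}"
    and compl: "infinite (generate G D) \<or> card (D - {\<one>}) < card (generate G D - B)"
  shows "\<exists>x\<in>D. card B + 1 \<le> 2 * expansion B x \<or> card (D - {\<one>}) + 1 \<le> 12 * expansion B x"
proof (cases "\<exists>E\<subseteq>generate G D. finite E \<and> 2 * card B \<le> card E")
  case True
  then show ?thesis by (rule exists_expanding[OF D B])
next
  case False
  let ?K = "generate G D"
  have K: "subgroup ?K G" using D(2) by (rule generate_is_subgroup)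
  have small: "card E < 2 * card B" if "E \<subseteq> ?K" "finite E" for E
    using False that by (meson not_le)
  have fin: "finite ?K"
  proof (rule ccontr)
    assume "infinite ?K"
    then obtain E where "finite E" "card E = 2 * card B" "E \<subseteq> ?K"
      using infinite_arbitrarily_large by metis
    with small[of E] show False by simp
  qed
  have "card ?K < 2 * card B" using small[OF order_refl fin] .
  moreover have "card (?K - B) = card ?K - card B"
    using B by (intro card_Diff_subset) auto
  ultimately have "2 * card (?K - B) \<le> card ?K" by simp
  with fin have big: "\<exists>E\<subseteq>?K. finite E \<and> 2 * card (?K - B) \<le> card E" by blast
  have "?K - B \<noteq> {}" using compl fin by (metis card.empty not_less_zero)
  from exists_expanding[OF D finite_Diff[OF fin] Diff_subset this big]
  obtain x where x: "x \<in> D" "card (?K - B) + 1 \<le> 2 * expansion (?K - B) x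
      \<or> card (D - {\<one>}) + 1 \<le> 12 * expansion (?K - B) x" by blast
  moreover have "expansion (?K - B) x = expansion B x"
    using x(1) by (intro expansion_compl[OF K fin B(2)] generate.incl)
  moreover have "card (D - {\<one>}) < card (?K - B)" using compl fin by blast
  ultimately have "card B + 1 \<le> 2 * expansion B x \<or> card (D - {\<one>}) + 1 \<le> 12 * expansion B x"
    by linarith
  with x(1) show ?thesis by blast
qed

text \<open>Pigeonhole: for \<open>y\<close> in the subgroup, the |D - {1}| + 1 elements y (inv d),
  with \<open>d\<close> in \<open>D\<close> or d = 1, cannot all avoid \<open>B\<close>, so
  \<open>y\<close> lies in some Bd. This handles the sets \<open>B\<close> excluded from
  \<open>exists_expanding_if_large_compl\<close>.\<close>

lemma set_mult_eq_generate:
  assumes D: "finite D" "D \<subseteq> carrier G" and B: "B \<subseteq> generate G D"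
    and Y: "insert \<one> D \<subseteq> Y" "Y \<subseteq> generate G D"
    and fin: "finite (generate G D)" and card: "card (generate G D - B) \<le> card (D - {\<one>})"
  shows "B <#> Y = generate G D"
proof
  let ?K = "generate G D"
  have K: "subgroup ?K G" using D(2) by (rule generate_is_subgroup)
  have KG: "?K \<subseteq> carrier G" using K by (rule subgroup.subset)
  show "B <#> Y \<subseteq> ?K" using B Y subgroup.m_closed[OF K] by (auto simp: set_mult_def)
  show "?K \<subseteq> B <#> Y"
  proof
    fix y assume y: "y \<in> ?K"
    let ?T = "(\<lambda>d. y \<otimes> inv d) ` insert \<one> D"
    have "inj_on (\<lambda>d. y \<otimes> inv d) (insert \<one> D)"
    proof (rule inj_onI)
      fix d d' assume "d \<in> insert \<one> D" "d' \<in> insert \<one> D" and eq: "y \<otimes> inv d = y \<otimes> inv d'"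
      then have "d \<in> carrier G" "d' \<in> carrier G" "y \<in> carrier G" using y KG D(2) by auto
      with eq show "d = d'" by (metis Units_eq Units_l_cancel inv_closed inv_inv)
    qed
    then have "card ?T = card (insert \<one> (D - {\<one>}))" by (subst insert_Diff_single) (rule card_image)
    also have "\<dots> = card (D - {\<one>}) + 1" using D(1) by (subst card_insert_disjoint) auto
    finally have card_T: "card ?T = card (D - {\<one>}) + 1" .
    have "\<not> ?T \<subseteq> ?K - B"
    proof
      assume "?T \<subseteq> ?K - B"
      then have "card ?T \<le> card (?K - B)" by (rule card_mono[OF finite_Diff[OF fin]])
      with card card_T show False by linarith
    qed
    then obtain d where d: "d \<in> insert \<one> D" "y \<otimes> inv d \<notin> ?K - B" by blast
    moreover have "d \<in> ?K" using d(1) Y by blast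
    moreover from this have "y \<otimes> inv d \<in> ?K"
      using y subgroup.m_closed[OF K] subgroup.m_inv_closed[OF K] by simp
    ultimately have dB: "y \<otimes> inv d \<in> B" by blast
    have "d \<in> carrier G" "y \<in> carrier G" using \<open>d \<in> ?K\<close> y KG by auto
    then have "(y \<otimes> inv d) \<otimes> d = y" by (simp add: m_assoc)
    with d dB Y show "y \<in> B <#> Y" unfolding set_mult_def by blast
  qed
qed

section \<open>Levels of multiplicities\<close>

text \<open>In the quotient by \<open>H\<close> the identity is the coset \<open>H\<close>, so for j
  \<ge> 1 these sets become the rich cosets.\<close>

definition level :: "'a list \<Rightarrow> nat \<Rightarrow> 'a set" where
  "level xs j = {x \<in> set xs - {\<one>}. j \<le> count_list xs x}"

definition energy :: "'a list \<Rightarrow> nat" where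
  "energy xs = (\<Sum>j=1..length xs. (card (level xs j))\<^sup>2)"

lemma finite_level: "finite (level xs j)"
  by (simp add: level_def)

lemma card_level_le: "card (level xs j) \<le> card (set xs - {\<one>})"
  by (intro card_mono) (auto simp: level_def)

text \<open>The term j = 1 alone gives this. It serves to absorb the mixed product nt in
  \<open>split_bound\<close>.\<close>

lemma square_card_le_energy: "(card (set xs - {\<one>}))\<^sup>2 \<le> energy xs"
proof (cases xs)
  case (Cons y ys)
  have "count_list xs x \<ge> 1" if "x \<in> set xs" for x
    using that count_list_0_iff[of xs x] by linarith
  then have "level xs 1 = set xs - {\<one>}" by (auto simp: level_def)
  moreover have "(card (level xs 1))\<^sup>2 \<le> energy xs"
    unfolding energy_def using Cons by (intro member_le_sum) auto
  ultimately show ?thesis by simp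
qed simp

text \<open>If \<open>x\<close> has multiplicity m, only level m changes: it loses \<open>x\<close>.
  A level of size d thereby loses d^2 - (d - 1)^2 < 2d.\<close>

lemma energy_remove1:
  assumes x: "x \<in> set xs" "x \<noteq> \<one>"
  shows "energy xs \<le> energy (remove1 x xs) + 2 * card (set xs - {\<one>})"
proof -
  let ?ys = "remove1 x xs" and ?m = "count_list xs x"
  have len: "length xs = Suc (length ?ys)"
    using x(1) length_pos_if_in_set[OF x(1)] by (simp add: length_remove1)
  have m: "1 \<le> ?m" "?m \<le> length xs"
    using x(1) count_list_0_iff[of xs x] count_le_length[of xs x] by linarith+
  have mem: "y \<in> level zs j \<longleftrightarrow> y \<noteq> \<one> \<and> j \<le> count_list zs y" if "j \<ge> 1" for y zs j
    using that count_list_0_iff[of zs y] by (auto simp: level_def)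
  have same: "level xs j = level ?ys j" if "j \<ge> 1" "j \<noteq> ?m" for j
    using that by (auto simp: mem)
  have "level xs ?m = insert x (level ?ys ?m)" "x \<notin> level ?ys ?m"
    using m(1) x(2) by (auto simp: mem split: if_splits)
  then have card: "card (level xs ?m) = card (level ?ys ?m) + 1"
    by (simp add: finite_level)
  \<comment> \<open>The energy of \<open>?ys\<close> has one summand fewer; an empty level is added
    so that both sums have the same range.\<close>
  have "level ?ys (length xs) = {}"
  proof -
    have "\<not> length xs \<le> count_list ?ys y" for y
      using len count_le_length[of ?ys y] by linarith
    then show ?thesis unfolding level_def by blast
  qed
  then have energy': "energy ?ys = (\<Sum>j=1..length xs. (card (level ?ys j))\<^sup>2)"
    unfolding energy_def len by simp
  have "energy xs = (card (level xs ?m))\<^sup>2 + (\<Sum>j\<in>{1..length xs} - {?m}. (card (level xs j))\<^sup>2)"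
    unfolding energy_def using m by (intro sum.remove) auto
  also have "(\<Sum>j\<in>{1..length xs} - {?m}. (card (level xs j))\<^sup>2)
      = (\<Sum>j\<in>{1..length xs} - {?m}. (card (level ?ys j))\<^sup>2)"
    by (intro sum.cong) (auto simp: same)
  also have "(card (level xs ?m))\<^sup>2 \<le> (card (level ?ys ?m))\<^sup>2 + 2 * card (level xs ?m)"
    unfolding card by (simp add: power2_eq_square)
  also have "(card (level ?ys ?m))\<^sup>2 + 2 * card (level xs ?m)
        + (\<Sum>j\<in>{1..length xs} - {?m}. (card (level ?ys j))\<^sup>2)
      = energy ?ys + 2 * card (level xs ?m)"
    unfolding energy' using m by (subst sum.remove[of _ ?m]) auto
  also have "\<dots> \<le> energy ?ys + 2 * card (set xs - {\<one>})"
    using card_level_le by simp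
  finally show ?thesis by simp
qed

section \<open>The aperiodic case\<close>

lemma subseq_sums_snoc:
  assumes "set xs \<subseteq> carrier G" "x \<in> carrier G"
  shows "subseq_sums G (xs @ [x]) = subseq_sums G xs \<union> (x <# subseq_sums G xs)"
proof -
  have "subseq_sums G [x] = {\<one>, x}"
    using assms(2) by (auto simp: subseq_sums_Cons subseq_sums_Nil l_coset_eq_image)
  then have "subseq_sums G (xs @ [x]) = subseq_sums G xs <#> {\<one>, x}"
    using assms by (simp add: subseq_sums_append)
  moreover have "y \<otimes> \<one> = y" "y \<otimes> x = x \<otimes> y" if "y \<in> subseq_sums G xs" for y
    using that assms subseq_sums_closed[of xs] by (auto simp: m_comm)
  ultimately show ?thesis by (auto simp: set_mult_def l_coset_eq_image)
qed

text \<open>If \<Sigma>(C) missed too few elements of the subgroup,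
  \<open>set_mult_eq_generate\<close> would make \<Sigma>(C @ R) the whole nontrivial subgroup,
  which is its own stabiliser.\<close>

lemma exists_expanding_term:
  assumes C: "set C \<subseteq> carrier G" and R: "set R \<subseteq> carrier G"
    and gen: "generate G (set R) = generate G (set (C @ R))" "generate G (set R) \<noteq> {\<one>}"
    and aper: "stab G (subseq_sums G (C @ R)) = {\<one>}"
  shows "\<exists>x\<in>set R. card (subseq_sums G C) + 1 \<le> 2 * expansion (subseq_sums G C) x
      \<or> card (set R - {\<one>}) + 1 \<le> 12 * expansion (subseq_sums G C) x"
proof -
  let ?K = "generate G (set R)"
  have K: "subgroup ?K G" using R by (rule generate_is_subgroup)
  have "set (C @ R) \<subseteq> ?K" unfolding gen(1) by (auto intro: generate.incl)
  then have CK: "subseq_sums G C \<subseteq> ?K" and RK: "subseq_sums G R \<subseteq> ?K"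
    using subseq_sums_subset_generate[OF _ K] by auto
  have "\<not> (finite ?K \<and> card (?K - subseq_sums G C) \<le> card (set R - {\<one>}))"
  proof
    assume *: "finite ?K \<and> card (?K - subseq_sums G C) \<le> card (set R - {\<one>})"
    have "subseq_sums G (C @ R) = ?K"
      using * one_in_subseq_sums[OF R] set_subset_subseq_sums[OF R]
      by (subst subseq_sums_append[OF C R], intro set_mult_eq_generate[OF _ R CK _ RK]) auto
    moreover have "?K \<subseteq> stab G ?K"
      using K coset_join3 subgroup.mem_carrier[OF K] by (auto simp: stab_def)
    ultimately show False
      using aper gen(2) subgroup.one_closed[OF K] by auto
  qed
  then show ?thesis
    using one_in_subseq_sums[OF C]
    by (intro exists_expanding_if_large_compl[OF _ R finite_subseq_sums CK]) auto
qed

section \<open>Greedy transfer of terms\<close>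

text \<open>
  Here \<open>t\<close> counts the steps that multiply \<open>card (subseq_sums G C) + 1\<close> by at least \<open>3 / 2\<close>, and \<open>P\<close> is
  the energy lost in the remaining steps.
\<close>

definition greedy_state :: "'a list \<Rightarrow> 'a list \<Rightarrow> 'a list \<Rightarrow> nat \<Rightarrow> nat \<Rightarrow> bool" where
  "greedy_state a C R t P \<longleftrightarrow>
     set C \<union> set R = set a \<and> subseq_sums G (C @ R) = subseq_sums G a \<and>
     energy a \<le> energy R + 2 * card (set a - {\<one>}) * t + P \<and>
     2 * (3 / 2) ^ t + real P / 24 \<le> real (card (subseq_sums G C)) + 1"

text \<open>A multiplicative step raises \<open>t\<close> and keeps \<open>P\<close>. In the other
  case, with d distinct nontrivial terms in \<open>R\<close>, the sum set gains more than d/12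
  elements while \<open>P\<close> grows by 2d, hence the weight 1/24 of \<open>P\<close>.\<close>

lemma greedy_step:
  assumes a: "set a \<subseteq> carrier G" "stab G (subseq_sums G a) = {\<one>}" "generate G (set a) \<noteq> {\<one>}"
    and st: "greedy_state a C R t P" and gen: "generate G (set R) = generate G (set a)"
  shows "\<exists>x\<in>set R. \<exists>t P. greedy_state a (C @ [x]) (remove1 x R) t P"
proof -
  let ?B = "subseq_sums G C"
  have CR: "set C \<union> set R = set a" "subseq_sums G (C @ R) = subseq_sums G a"
    and en: "energy a \<le> energy R + 2 * card (set a - {\<one>}) * t + P"
    and cd: "2 * (3 / 2) ^ t + real P / 24 \<le> real (card ?B) + 1"
    using st by (auto simp: greedy_state_def)
  have C: "set C \<subseteq> carrier G" and R: "set R \<subseteq> carrier G" using CR a by auto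
  have BG: "?B \<subseteq> carrier G" using C by (rule subseq_sums_closed)
  obtain x where x: "x \<in> set R" and
    exp: "card ?B + 1 \<le> 2 * expansion ?B x \<or> card (set R - {\<one>}) + 1 \<le> 12 * expansion ?B x"
    using exists_expanding_term[OF C R] gen a CR by auto
  have xG: "x \<in> carrier G" using x R by blast
  \<comment> \<open>The identity has expansion 0 and satisfies neither alternative.\<close>
  have "x \<noteq> \<one>" using exp expansion_one[OF BG] by auto
  then have en': "energy R \<le> energy (remove1 x R) + 2 * card (set R - {\<one>})"
    using x by (intro energy_remove1)
  have le: "card (set R - {\<one>}) \<le> card (set a - {\<one>})"
    using CR(1) by (intro card_mono) auto
  have rem: "set (remove1 x R) \<subseteq> carrier G" "set (remove1 x R) \<subseteq> set R"
    using R set_remove1_subset by fast+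
  have "set (C @ [x]) \<union> set (remove1 x R) = set a"
  proof -
    have "set R \<subseteq> insert x (set (remove1 x R))"
      by (metis in_set_remove1 insertI1 insertI2 subsetI)
    with rem(2) x CR(1) show ?thesis by auto
  qed
  moreover have "subseq_sums G ((C @ [x]) @ remove1 x R) = subseq_sums G a"
    using subseq_sums_append[OF C, of "x # remove1 x R"] subseq_sums_append[OF C R]
      subseq_sums_remove1[OF R x] CR(2) xG rem by simp
  moreover have card: "card (subseq_sums G (C @ [x])) = card ?B + expansion ?B x"
    using subseq_sums_snoc[OF C xG] card_Un_l_coset[OF finite_subseq_sums] by simp
  moreover have "\<exists>t' P'. energy a \<le> energy (remove1 x R) + 2 * card (set a - {\<one>}) * t' + P' \<and>
      2 * (3 / 2) ^ t' + real P' / 24 \<le> real (card ?B + expansion ?B x) + 1"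
    using exp
  proof
    assume "card ?B + 1 \<le> 2 * expansion ?B x"
    then have "real (card ?B) + 1 \<le> 2 * real (expansion ?B x)" by linarith
    then have "2 * (3 / 2) ^ Suc t + real P / 24 \<le> real (card ?B + expansion ?B x) + 1"
      using cd by simp
    moreover have "energy a \<le> energy (remove1 x R) + 2 * card (set a - {\<one>}) * Suc t + P"
      using en en' le by simp
    ultimately show ?thesis by blast
  next
    assume "card (set R - {\<one>}) + 1 \<le> 12 * expansion ?B x"
    then have "real (card (set R - {\<one>})) + 1 \<le> 12 * real (expansion ?B x)" by linarith
    moreover have "real (P + 2 * card (set R - {\<one>})) / 24 = real P / 24 + real (card (set R - {\<one>})) / 12"
      by (simp add: field_simps)
    ultimately have "2 * (3 / 2) ^ t + real (P + 2 * card (set R - {\<one>})) / 24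
        \<le> real (card ?B + expansion ?B x) + 1"
      using cd unfolding of_nat_add[of "card ?B"] by linarith
    moreover have "energy a \<le> energy (remove1 x R) + 2 * card (set a - {\<one>}) * t
        + (P + 2 * card (set R - {\<one>}))"
      using en en' by simp
    ultimately show ?thesis by blast
  qed
  ultimately have "\<exists>t P. greedy_state a (C @ [x]) (remove1 x R) t P"
    unfolding greedy_state_def by (simp only:) blast
  with x show ?thesis by blast
qed

lemma greedy_split:
  assumes a: "set a \<subseteq> carrier G" "stab G (subseq_sums G a) = {\<one>}" "generate G (set a) \<noteq> {\<one>}"
  shows "\<exists>C R t P. greedy_state a C R t P \<and> generate G (set R) \<noteq> generate G (set a)
      \<and> length R < length a"
proof -
  have "\<exists>C R t P. greedy_state a C R t P \<and> generate G (set R) \<noteq> generate G (set a)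
      \<and> length R < length a"
    if "greedy_state a C R t P" "generate G (set R) = generate G (set a)" "length R \<le> length a"
    for C R t P
    using that
  proof (induction "length R" arbitrary: C R t P rule: less_induct)
    case less
    obtain x t' P' where x: "x \<in> set R"
      and st: "greedy_state a (C @ [x]) (remove1 x R) t' P'"
      using greedy_step[OF a less.prems(1,2)] by blast
    have len: "length (remove1 x R) < length R"
      using x length_pos_if_in_set[OF x] by (simp add: length_remove1)
    show ?case
    proof (cases "generate G (set (remove1 x R)) = generate G (set a)")
      case True
      then show ?thesis using less.hyps[OF len st] len less.prems(3) by simp
    next
      case False
      then show ?thesis using st len less.prems(3) by (meson less_le_trans)
    qed
  qed
  \<comment> \<open>Initially |\<Sigma>(C)| + 1 = 2, which is the leading factor in
    2(3/2)^t.\<close>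
  moreover have "greedy_state a [] a 0 0"
    by (simp add: greedy_state_def subseq_sums_Nil)
  ultimately show ?thesis by blast
qed

end

section \<open>Numerical inequalities\<close>

lemma square_le_three_halves_power: "real (t\<^sup>2) + 2 \<le> 6 * (3 / 2) ^ t"
proof (induction t)
  case (Suc t)
  consider "t = 0" | "t = 1" | "t = 2" | "t = 3" | "t \<ge> 4" by linarith
  then show ?case
  proof cases
    \<comment> \<open>The inductive step needs (t + 1)^2 + 2 \<le> (3/2)(t^2 + 2), that is t^2 \<ge>
      4t.\<close>
    case 5
    then have "4 * real t \<le> real t * real t" by (intro mult_right_mono) auto
    then show ?thesis using Suc by (simp add: power2_eq_square algebra_simps)
  qed (simp_all add: eval_nat_numeral)
qed simp

text \<open>\<open>E\<close> and \<open>F\<close> stand for the energies of \<open>a\<close> and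
  \<open>R\<close>, \<open>n\<close> for the number of distinct nontrivial terms of
  \<open>a\<close>, and \<open>c\<close>, \<open>s\<close>, \<open>N\<close> for the sizes of
  \<Sigma>(C), \<Sigma>(R), \<Sigma>(a).\<close>

lemma split_bound:
  fixes E F n t P c s N :: nat
  assumes "E \<le> F + 2 * n * t + P" "n\<^sup>2 \<le> E" "2 * (3 / 2) ^ t + real P / 24 \<le> real c + 1"
    and "F + 64 \<le> 64 * s" "c \<le> N" "2 * s \<le> N"
  shows "E + 64 \<le> 64 * N"
proof (rule ccontr)
  assume "\<not> E + 64 \<le> 64 * N"
  \<comment> \<open>If the claim fails, then F < E/2 - 32 and 24c < 3E/8 + 24. Together with 2nt
    \<le> E/8 + 8t^2 and 8t^2 + P \<le> 24c + 8 this yields E < E; the constant 64 makes the terms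
    balance exactly.\<close>
  then have "2 * real F + 64 < real E" "64 * real c < real E + 64"
    using assms(4-6) by linarith+
  moreover have "real E \<le> real F + 2 * (real n * real t) + real P"
    using assms(1) by (simp flip: of_nat_mult of_nat_add)
  moreover have "(real n)\<^sup>2 \<le> real E" using assms(2) by (simp flip: of_nat_power)
  moreover have "(real t)\<^sup>2 + 2 \<le> 6 * (3 / 2) ^ t"
    using square_le_three_halves_power[of t] by simp
  \<comment> \<open>This is 2nt \<le> n^2/8 + 8t^2, with weights chosen so that n^2 costs only
    E/8.\<close>
  moreover have "0 \<le> (real n)\<^sup>2 - 16 * (real n * real t) + 64 * (real t)\<^sup>2"
    using zero_le_power2[of "real n - 8 * real t"] by (simp add: power2_eq_square algebra_simps)
  ultimately show False using assms(3) by linarith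
qed

context comm_group
begin

text \<open>Strong induction on the length, applied to the remainder \<open>R\<close> of a greedy
  split. The summand 64 corresponds to the term |H| with |H| = 1.\<close>

lemma energy_le_card_subseq_sums:
  assumes "set a \<subseteq> carrier G" "stab G (subseq_sums G a) = {\<one>}"
  shows "energy a + 64 \<le> 64 * card (subseq_sums G a)"
  using assms
proof (induction "length a" arbitrary: a rule: less_induct)
  case less
  note a = less.prems
  have pos: "1 \<le> card (subseq_sums G a)"
    using one_in_subseq_sums[OF a(1)] finite_subseq_sums[of G a] card_gt_0_iff[of "subseq_sums G a"] by force
  show ?case
  proof (cases "generate G (set a) = {\<one>}")
    case True
    then have "set a \<subseteq> {\<one>}" by (auto intro: generate.incl)
    then have "level a j = {}" for j by (auto simp: level_def)
    then show ?thesis using pos by (simp add: energy_def)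
  next
    case False
    obtain C R t P where st: "greedy_state a C R t P"
      and gen: "generate G (set R) \<noteq> generate G (set a)" and len: "length R < length a"
      using greedy_split[OF a False] by blast
    have CR: "set C \<union> set R = set a" "subseq_sums G (C @ R) = subseq_sums G a"
      using st by (auto simp: greedy_state_def)
    have C: "set C \<subseteq> carrier G" and R: "set R \<subseteq> carrier G" using CR a by auto
    have sums: "subseq_sums G a = subseq_sums G C <#> subseq_sums G R"
      using CR(2) subseq_sums_append[OF C R] by simp
    have CG: "subseq_sums G C \<subseteq> carrier G" and RG: "subseq_sums G R \<subseteq> carrier G"
      using C R subseq_sums_closed by auto
    have "stab G (subseq_sums G R) \<subseteq> {\<one>}"
      using stab_set_mult[OF CG RG] a(2) sums by simp
    moreover have "\<one> \<in> stab G (subseq_sums G R)"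
      using RG by (simp add: stab_def lcos_mult_one)
    ultimately have IH: "energy R + 64 \<le> 64 * card (subseq_sums G R)"
      using less.hyps[OF len R] by blast
    let ?L = "generate G (set R)"
    have L: "subgroup ?L G" using R by (rule generate_is_subgroup)
    \<comment> \<open>Otherwise \<open>R\<close> would generate every term of
      \<open>a\<close>.\<close>
    have "\<not> set C \<subseteq> ?L"
    proof
      assume "set C \<subseteq> ?L"
      then have "set a \<subseteq> ?L" using CR(1) by (auto intro: generate.incl)
      then have "generate G (set a) \<subseteq> ?L" using L generate_subgroup_incl by blast
      moreover have "?L \<subseteq> generate G (set a)" using CR(1) by (intro mono_generate) auto
      ultimately show False using gen by blast
    qed
    then obtain c where c: "c \<in> set C" "c \<notin> ?L" by blast
    have RL: "subseq_sums G R \<subseteq> ?L"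
      by (rule subseq_sums_subset_generate[OF _ L]) (auto intro: generate.incl)
    have cG: "c \<in> carrier G" using c C by blast
    \<comment> \<open>The two sets lie in different cosets of \<open>?L\<close>.\<close>
    have "subseq_sums G R \<inter> (c <# subseq_sums G R) = {}"
    proof (rule ccontr)
      assume "subseq_sums G R \<inter> (c <# subseq_sums G R) \<noteq> {}"
      then obtain r r' where r: "r \<in> subseq_sums G R" "r' \<in> subseq_sums G R" "r' = c \<otimes> r"
        by (auto simp: l_coset_eq_image)
      then have "c = r' \<otimes> inv r" using cG RG by (auto simp: m_assoc)
      moreover have "r' \<otimes> inv r \<in> ?L"
        using r(1,2) RL by (intro subgroup.m_closed[OF L] subgroup.m_inv_closed[OF L]) auto
      ultimately show False using c(2) by simp
    qed
    then have "2 * card (subseq_sums G R) = card (subseq_sums G R \<union> (c <# subseq_sums G R))"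
      using card_l_coset[OF cG RG]
      by (subst card_Un_disjoint) (auto simp: finite_subseq_sums l_coset_eq_image)
    also have "\<dots> \<le> card (subseq_sums G a)"
    proof (intro card_mono finite_subseq_sums Un_least)
      show "c <# subseq_sums G R \<subseteq> subseq_sums G a"
        using set_subset_subseq_sums[OF C] c(1)
        unfolding sums l_coset_eq_image set_mult_def by blast
      have "\<one> <# subseq_sums G R \<subseteq> subseq_sums G a"
        using one_in_subseq_sums[OF C]
        unfolding sums l_coset_eq_image set_mult_def by blast
      then show "subseq_sums G R \<subseteq> subseq_sums G a" using RG by (simp add: lcos_mult_one)
    qed
    finally have two: "2 * card (subseq_sums G R) \<le> card (subseq_sums G a)" .
    have "subseq_sums G C \<subseteq> subseq_sums G a"
    proof
      fix y assume y: "y \<in> subseq_sums G C"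
      then have "y \<otimes> \<one> \<in> subseq_sums G a"
        using one_in_subseq_sums[OF R] unfolding sums set_mult_def by blast
      then show "y \<in> subseq_sums G a" using y CG by auto
    qed
    then have "card (subseq_sums G C) \<le> card (subseq_sums G a)"
      by (intro card_mono finite_subseq_sums)
    moreover have "energy a \<le> energy R + 2 * card (set a - {\<one>}) * t + P"
      "2 * (3 / 2) ^ t + real P / 24 \<le> real (card (subseq_sums G C)) + 1"
      using st by (simp_all only: greedy_state_def)
    ultimately show ?thesis
      using split_bound[OF _ square_card_le_energy _ IH _ two] by blast
  qed
qed

section \<open>Reduction to the aperiodic case\<close>

lemma subgroup_stab:
  assumes "X \<subseteq> carrier G"
  shows "subgroup (stab G X) G"
proof (rule subgroupI)
  show "stab G X \<subseteq> carrier G" by (auto simp: stab_def)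
  have "\<one> \<in> stab G X" using assms by (simp add: stab_def lcos_mult_one)
  then show "stab G X \<noteq> {}" by blast
  show "inv g \<in> stab G X" if "g \<in> stab G X" for g
  proof -
    have g: "g \<in> carrier G" "g <# X = X" using that by (auto simp: stab_def)
    have "inv g <# (g <# X) = X" using assms g(1) by (simp add: lcos_m_assoc lcos_mult_one)
    then show ?thesis using g by (simp add: stab_def)
  qed
  show "g \<otimes> h \<in> stab G X" if "g \<in> stab G X" "h \<in> stab G X" for g h
    using that assms by (simp add: stab_def lcos_m_assoc[symmetric])
qed

lemma comm_group_FactGroup:
  assumes "subgroup H G"
  shows "comm_group (G Mod H)"
proof -
  interpret normal H G using assms by (rule subgroup_imp_normal)
  show ?thesis
  proof (rule group.group_comm_groupI[OF factorgroup_is_group])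
    fix X Y assume "X \<in> carrier (G Mod H)" "Y \<in> carrier (G Mod H)"
    then obtain x y where "x \<in> carrier G" "y \<in> carrier G" "X = H #> x" "Y = H #> y"
      by (auto simp: carrier_FactGroup)
    then show "X \<otimes>\<^bsub>G Mod H\<^esub> Y = Y \<otimes>\<^bsub>G Mod H\<^esub> X"
      by (simp add: rcos_sum m_comm)
  qed
qed

end

lemma subseq_sums_hom:
  assumes "comm_group G" "comm_group K" "f \<in> hom G K" "set xs \<subseteq> carrier G"
  shows "subseq_sums K (map f xs) = f ` subseq_sums G xs"
proof -
  interpret G: comm_group G by fact
  interpret K: comm_group K by fact
  interpret f: group_hom G K f using assms(3) by unfold_locales
  show ?thesis
    using assms(4)
  proof (induction xs)
    case Nil
    then show ?case by (simp add: G.subseq_sums_Nil K.subseq_sums_Nil)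
  next
    case (Cons x xs)
    have "set (map f xs) \<subseteq> carrier K" using Cons.prems by auto
    moreover have "f (x \<otimes>\<^bsub>G\<^esub> y) = f x \<otimes>\<^bsub>K\<^esub> f y" if "y \<in> subseq_sums G xs" for y
      using that Cons.prems G.subseq_sums_closed[of xs] by auto
    ultimately show ?case
      using Cons by (simp add: G.subseq_sums_Cons K.subseq_sums_Cons l_coset_eq_image image_Un image_image)
  qed
qed

theorem theorem6:
  fixes G :: "('g, 'b) monoid_scheme" and a :: "'g list" and H :: "'g set"
  assumes "comm_group G"
    and "set a \<subseteq> carrier G"
    and "H = stab G (subseq_sums G a)"
  shows "real (card (subseq_sums G a)) \<ge>
           real (card H) + 1 / 64 * real (card H) * (\<Sum>\<^sub>\<infinity>j\<in>{1..}. (real (rho G H a j))\<^sup>2)"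
proof -
  interpret comm_group G by fact
  let ?X = "subseq_sums G a" and ?f = "\<lambda>x. H #>\<^bsub>G\<^esub> x"
  have XG: "?X \<subseteq> carrier G" using assms(2) by (rule subseq_sums_closed)
  have H: "subgroup H G" unfolding assms(3) using XG by (rule subgroup_stab)
  interpret normal H G using H by (rule subgroup_imp_normal)
  interpret Q: comm_group "G Mod H" using H by (rule comm_group_FactGroup)
  have sums: "subseq_sums (G Mod H) (map ?f a) = ?f ` ?X"
    by (rule subseq_sums_hom[OF assms(1) Q.comm_group_axioms r_coset_hom_Mod assms(2)])
  \<comment> \<open>Being stable under \<open>H\<close>, the sum set is a union of
    \<open>H\<close>-cosets, so its size is |H| times that of its image in the quotient.\<close>
  have coset_X: "?f x \<subseteq> ?X" if "x \<in> ?X" for x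
  proof
    fix y assume "y \<in> ?f x"
    then obtain h where h: "h \<in> H" "y = h \<otimes>\<^bsub>G\<^esub> x" by (auto simp: r_coset_def)
    have "h <#\<^bsub>G\<^esub> ?X = ?X" using h(1) unfolding assms(3) stab_def by blast
    moreover have "y \<in> h <#\<^bsub>G\<^esub> ?X" unfolding h(2) l_coset_eq_image using that by (rule imageI)
    ultimately show "y \<in> ?X" by blast
  qed
  have self: "x \<in> ?f x" if "x \<in> carrier G" for x
    using that H by (rule rcos_self)
  have "card H * card (?f ` ?X) = card (\<Union>(?f ` ?X))"
  proof (rule card_partition)
    have sub: "?f ` ?X \<subseteq> rcosets\<^bsub>G\<^esub> H" using XG by (auto simp: RCOSETS_def)
    show "card c = card H" if "c \<in> ?f ` ?X" for c
    proof -
      have "c \<in> rcosets\<^bsub>G\<^esub> H" using that sub by blast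
      from card_rcosets_equal[OF this subset] show ?thesis by (rule sym)
    qed
    show "c1 \<inter> c2 = {}" if "c1 \<in> ?f ` ?X" "c2 \<in> ?f ` ?X" "c1 \<noteq> c2" for c1 c2
      using that sub rcos_disjoint[OF H] by (auto simp: pairwise_def disjnt_def)
    show "finite (\<Union>(?f ` ?X))"
      using coset_X by (intro finite_subset[OF _ finite_subseq_sums[of G a]] UN_least)
  qed (simp add: finite_subseq_sums)
  also have "\<Union>(?f ` ?X) = ?X"
  proof
    show "\<Union>(?f ` ?X) \<subseteq> ?X" using coset_X by auto
    show "?X \<subseteq> \<Union>(?f ` ?X)" using self XG by (meson UN_I subset_iff)
  qed
  finally have card_X: "card ?X = card H * card (subseq_sums (G Mod H) (map ?f a))"
    by (simp add: sums)
  have aQ: "set (map ?f a) \<subseteq> carrier (G Mod H)"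
    using assms(2) by (auto simp: carrier_FactGroup)
  \<comment> \<open>If Hg stabilises the image, then gX \<subseteq> X because \<open>?X\<close> is a
    union of cosets. Translation preserves the finite cardinality, so gX = X and g lies in
    \<open>H\<close>.\<close>
  have stab: "stab (G Mod H) (?f ` ?X) = {H}"
  proof
    have "subgroup (stab (G Mod H) (?f ` ?X)) (G Mod H)"
      using Q.subseq_sums_closed[OF aQ] unfolding sums by (rule Q.subgroup_stab)
    from subgroup.one_closed[OF this] show "{H} \<subseteq> stab (G Mod H) (?f ` ?X)"
      unfolding one_FactGroup by blast
    show "stab (G Mod H) (?f ` ?X) \<subseteq> {H}"
    proof
      fix q assume q: "q \<in> stab (G Mod H) (?f ` ?X)"
      then have qX: "q \<in> carrier (G Mod H)" "q <#\<^bsub>G Mod H\<^esub> (?f ` ?X) = ?f ` ?X"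
        unfolding stab_def by blast+
      from qX(1) obtain g where g: "g \<in> carrier G" "q = ?f g"
        unfolding carrier_FactGroup by blast
      have "g <#\<^bsub>G\<^esub> ?X \<subseteq> ?X"
      proof
        fix y assume "y \<in> g <#\<^bsub>G\<^esub> ?X"
        then obtain x where x: "x \<in> ?X" "y = g \<otimes>\<^bsub>G\<^esub> x" by (auto simp: l_coset_eq_image)
        then have xy: "x \<in> carrier G" "y \<in> carrier G" using XG g(1) by auto
        have "?f y = q \<otimes>\<^bsub>G Mod H\<^esub> ?f x" 
          unfolding g(2) x(2) using rcos_sum[OF g(1) xy(1)] by simp
        also have "\<dots> \<in> q <#\<^bsub>G Mod H\<^esub> (?f ` ?X)" using x unfolding l_coset_eq_image by blast
        finally have "?f y \<in> ?f ` ?X" unfolding qX(2) .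
        then obtain x' where "x' \<in> ?X" "?f y = ?f x'" by (rule imageE)
        then show "y \<in> ?X" using coset_X[of x'] self[OF xy(2)] by blast
      qed
      from card_subset_eq[OF finite_subseq_sums this card_l_coset[OF g(1) XG]]
      have "g <#\<^bsub>G\<^esub> ?X = ?X" .
      then have "g \<in> H" using g(1) unfolding assms(3) stab_def by blast
      then show "q \<in> {H}" unfolding g(2) using coset_join2[OF g(1) H] by blast
    qed
  qed
  have bound: "Q.energy (map ?f a) + 64 \<le> 64 * card (subseq_sums (G Mod H) (map ?f a))"
    by (rule Q.energy_le_card_subseq_sums[OF aQ]) (simp only: sums stab one_FactGroup)
  \<comment> \<open>For j \<ge> 1 a rich coset contains a term of \<open>a\<close>, so it occurs in
    the projected list; for j = 0 cosets without terms would qualify too.\<close>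
  have "rich_cosets G H a j = Q.level (map ?f a) j" if "j \<ge> 1" for j
  proof -
    have count: "card {i. i < length a \<and> a ! i \<in> q} = count_list (map ?f a) q"
      if q: "q \<in> carrier (G Mod H)" for q
    proof -
      obtain g where g: "g \<in> carrier G" "q = ?f g" using q by (auto simp: carrier_FactGroup)
      have "a ! i \<in> q \<longleftrightarrow> q = map ?f a ! i" if "i < length a" for i
      proof -
        have "a ! i \<in> carrier G" using that assms(2) by auto
        then have "a ! i \<in> q \<longleftrightarrow> q = ?f (a ! i)"
          using g(2) self repr_independence[OF _ g(1) H, of "a ! i"] by blast
        then show ?thesis using that by simp
      qed
      then have "{i. i < length a \<and> a ! i \<in> q} = {i. i < length (map ?f a) \<and> q = map ?f a ! i}"
        by auto
      then show ?thesis
        unfolding count_list_eq_length_filter length_filter_conv_card by (rule arg_cong)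
    qed
    have mem: "q \<in> set (map ?f a)" if "j \<le> count_list (map ?f a) q" for q
      using that \<open>j \<ge> 1\<close> count_list_0_iff[of "map ?f a" q] by linarith
    show ?thesis
    proof (intro Set.set_eqI iffI)
      fix q assume "q \<in> rich_cosets G H a j"
      then show "q \<in> Q.level (map ?f a) j"
        using count[of q] mem[of q] by (simp add: rich_cosets_def Q.level_def del: set_map)
    next
      fix q assume q: "q \<in> Q.level (map ?f a) j"
      then have "q \<in> carrier (G Mod H)" using aQ by (auto simp: Q.level_def simp del: set_map)
      with q show "q \<in> rich_cosets G H a j"
        using count[of q] by (simp add: rich_cosets_def Q.level_def del: set_map)
    qed
  qed
  then have "(\<Sum>j=1..length a. (rho G H a j)\<^sup>2) = Q.energy (map ?f a)"
    unfolding rho_def Q.energy_def length_map by (intro sum.cong) auto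
  then have "(\<Sum>\<^sub>\<infinity>j\<in>{1..}. (real (rho G H a j))\<^sup>2) = real (Q.energy (map ?f a))"
    unfolding infsum_rho by (simp flip: of_nat_power of_nat_sum)
  moreover have "real (card H) * (real (Q.energy (map ?f a)) + 64)
      \<le> real (card H) * (64 * real (card (subseq_sums (G Mod H) (map ?f a))))"
    using bound by (intro mult_left_mono) linarith+
  ultimately show ?thesis
    by (simp add: card_X field_simps)
qed

end
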